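(* Let $\{W(s,t) : s,t\in[0,\infty)\}$ be a standard Wiener field and let $X(s,t):=\mathrm{e}^{-\frac{s}{2}-\frac{t}{2}}\,W(\mathrm{e}^{s},\mathrm{e}^{t})$, $s,t\in\mathbb{R}$, which is a stationary Ornstein-Uhlenbeck field with parameters $(\frac12,\frac12,1)$. Then the random field $\{U(s,t):(s,t)\in[0,1]\times[0,\infty)\}$ defined by $$U(s,t):=\begin{cases}\sqrt{s(1-s)t}\;X\!\left(\ln\!\left(\frac{s}{1-s}\right),\ln(t)\right) & \text{if }(s,t)\in(0,1)\times(0,\infty),\\ 0 & \text{if } s\in\{0,1\}\text{ or } t=0,\end{cases}$$ generates the same law on $C([0,1]\times[0,\infty))$ as a Kiefer process.
   Context: A random field $\{Y(s,t):(s,t)\in D\}$, $D\subseteq\mathbb{R}^2$, is a Gauss field if all its finite-dimensional distributions are (possibly degenerate) multivariate normal. It has continuous sample paths almost surely if $\mathbb{P}(\{\omega: D\ni(s,t)\mapsto Y(s,t)(\omega)\text{ is continuous}\})=1$. $C(D)$ is the space of continuous real-valued functions on $D$. Two fields generate the same law on $C(D)$ if both have continuous sample paths almost surely and the induced probability laws on $C(D)$ coincide. A standard Wiener field is a zero-mean Gauss field $\{W(s,t):s,t\in[0,\infty)\}$ with continuous sample paths almost surely and $\operatorname{Cov}(W(s_1,t_1),W(s_2,t_2))=\min(s_1,s_2)\min(t_1,t_2)$. A stationary Ornstein-Uhlenbeck field with parameters $(\frac12,\frac12,1)$ is a zero-mean Gauss field $\{X(s,t):s,t\in\mathbb{R}\}$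 with continuous sample paths almost surely and $\operatorname{Cov}(X(s_1,t_1),X(s_2,t_2))=\exp\{-\frac12|s_2-s_1|-\frac12|t_2-t_1|\}$. A Kiefer process is the field $K(s,t):=W(s,t)-sW(1,t)$, $s\in[0,1]$, $t\in[0,\infty)$, where $W$ is a standard Wiener field; it is a zero-mean Gauss field with continuous sample paths almost surely and covariance function $\operatorname{Cov}(K(s_1,t_1),K(s_2,t_2))=(\min(s_1,s_2)-s_1s_2)\min(t_1,t_2)$. *)

theory Defs
  imports "HOL-Probability.Probability"
begin

text \<open>A random field over the parameter set \<open>D\<close> is a function
  \<open>Y :: real \<times> real \<Rightarrow> 'a \<Rightarrow> real\<close> on a probability space \<open>M\<close>; its values at parameters
  outside \<open>D\<close> are irrelevant.\<close>

definition univ_normal :: "'a measure \<Rightarrow> ('a \<Rightarrow> real) \<Rightarrow> bool" where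
  "univ_normal M Z \<longleftrightarrow> Z \<in> borel_measurable M \<and>
     ((\<exists>\<mu> \<sigma>. \<sigma> > 0 \<and> distributed M lborel Z (normal_density \<mu> \<sigma>)) \<or>
      (\<exists>\<mu>. AE \<omega> in M. Z \<omega> = \<mu>))"

text \<open>Possibly degenerate multivariate normal distribution of the random vector
  \<open>(Z i)\<^sub>i\<^sub>\<in>\<^sub>I\<close> (for finite \<open>I\<close>): each linear combination of the components is normal
  or almost surely constant.\<close>

definition multi_normal :: "'a measure \<Rightarrow> 'i set \<Rightarrow> ('i \<Rightarrow> 'a \<Rightarrow> real) \<Rightarrow> bool" where
  "multi_normal M I Z \<longleftrightarrow> (\<forall>i\<in>I. Z i \<in> borel_measurable M) \<and>
     (\<forall>c :: 'i \<Rightarrow> real. univ_normal M (\<lambda>\<omega>. \<Sum>i\<in>I. c i * Z i \<omega>))"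

definition gauss_field ::
    "'a measure \<Rightarrow> (real \<times> real) set \<Rightarrow> (real \<times> real \<Rightarrow> 'a \<Rightarrow> real) \<Rightarrow> bool" where
  "gauss_field M D Y \<longleftrightarrow> prob_space M \<and>
     (\<forall>F. finite F \<longrightarrow> F \<subseteq> D \<longrightarrow> multi_normal M F Y)"

definition cov :: "'a measure \<Rightarrow> ('a \<Rightarrow> real) \<Rightarrow> ('a \<Rightarrow> real) \<Rightarrow> real" where
  "cov M Z Z' = (\<integral>\<omega>. (Z \<omega> - (\<integral>\<omega>'. Z \<omega>' \<partial>M)) * (Z' \<omega> - (\<integral>\<omega>'. Z' \<omega>' \<partial>M)) \<partial>M)"

definition zero_mean ::
    "'a measure \<Rightarrow> (real \<times> real) set \<Rightarrow> (real \<times> real \<Rightarrow> 'a \<Rightarrow> real) \<Rightarrow> bool" where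
  "zero_mean M D Y \<longleftrightarrow> (\<forall>p\<in>D. integrable M (Y p) \<and> (\<integral>\<omega>. Y p \<omega> \<partial>M) = 0)"

text \<open>The event need not be measurable in \<open>M\<close> itself; "probability one" is
  understood up to completion.\<close>

definition as_continuous ::
    "'a measure \<Rightarrow> (real \<times> real) set \<Rightarrow> (real \<times> real \<Rightarrow> 'a \<Rightarrow> real) \<Rightarrow> bool" where
  "as_continuous M D Y \<longleftrightarrow> (AE \<omega> in M. continuous_on D (\<lambda>p. Y p \<omega>))"

text \<open>Elements of \<open>C(D)\<close> are represented by functions that are \<open>undefined\<close> outside \<open>D\<close>.\<close>

definition C_space :: "(real \<times> real) set \<Rightarrow> (real \<times> real \<Rightarrow> real) set" where
  "C_space D = {f \<in> extensional D. continuous_on D f}"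

text \<open>Open sets of the topology of uniform convergence on compact subsets of \<open>D\<close>.\<close>

definition C_open :: "(real \<times> real) set \<Rightarrow> (real \<times> real \<Rightarrow> real) set \<Rightarrow> bool" where
  "C_open D V \<longleftrightarrow> V \<subseteq> C_space D \<and>
     (\<forall>f\<in>V. \<exists>K e. compact K \<and> K \<subseteq> D \<and> e > 0 \<and>
        (\<forall>g\<in>C_space D. (\<forall>p\<in>K. \<bar>g p - f p\<bar> < e) \<longrightarrow> g \<in> V))"

definition C_borel :: "(real \<times> real) set \<Rightarrow> (real \<times> real \<Rightarrow> real) measure" where
  "C_borel D = sigma (C_space D) {V. C_open D V}"

text \<open>The sample path as an element of \<open>C(D)\<close>; discontinuous paths, which have
  probability zero in all uses below, are replaced by the zero function.\<close>

definition sample_path ::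
    "(real \<times> real) set \<Rightarrow> (real \<times> real \<Rightarrow> 'a \<Rightarrow> real) \<Rightarrow> 'a \<Rightarrow> real \<times> real \<Rightarrow> real" where
  "sample_path D Y \<omega> =
     (if continuous_on D (\<lambda>p. Y p \<omega>) then (\<lambda>p\<in>D. Y p \<omega>) else (\<lambda>p\<in>D. 0))"

definition law_on_C ::
    "'a measure \<Rightarrow> (real \<times> real) set \<Rightarrow> (real \<times> real \<Rightarrow> 'a \<Rightarrow> real) \<Rightarrow> (real \<times> real \<Rightarrow> real) measure" where
  "law_on_C M D Y = distr (completion M) (C_borel D) (sample_path D Y)"

text \<open>Measurability is required explicitly because \<open>distr\<close> is the null measure for
  non-measurable maps.\<close>

definition same_law_on_C ::
    "(real \<times> real) set \<Rightarrow> 'a measure \<Rightarrow> (real \<times> real \<Rightarrow> 'a \<Rightarrow> real) \<Rightarrow>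
     'b measure \<Rightarrow> (real \<times> real \<Rightarrow> 'b \<Rightarrow> real) \<Rightarrow> bool" where
  "same_law_on_C D M Y N Z \<longleftrightarrow>
     as_continuous M D Y \<and> as_continuous N D Z \<and>
     sample_path D Y \<in> completion M \<rightarrow>\<^sub>M C_borel D \<and>
     sample_path D Z \<in> completion N \<rightarrow>\<^sub>M C_borel D \<and>
     law_on_C M D Y = law_on_C N D Z"

definition std_wiener_field :: "'a measure \<Rightarrow> (real \<times> real \<Rightarrow> 'a \<Rightarrow> real) \<Rightarrow> bool" where
  "std_wiener_field M W \<longleftrightarrow>
     gauss_field M ({0..} \<times> {0..}) W \<and> zero_mean M ({0..} \<times> {0..}) W \<and>
     as_continuous M ({0..} \<times> {0..}) W \<and>
     (\<forall>s1\<ge>0. \<forall>t1\<ge>0. \<forall>s2\<ge>0. \<forall>t2\<ge>0.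
        cov M (W (s1, t1)) (W (s2, t2)) = min s1 s2 * min t1 t2)"

text \<open>Stationary Ornstein-Uhlenbeck field with parameters \<open>(1/2, 1/2, 1)\<close>.\<close>

definition stationary_OU_field :: "'a measure \<Rightarrow> (real \<times> real \<Rightarrow> 'a \<Rightarrow> real) \<Rightarrow> bool" where
  "stationary_OU_field M X \<longleftrightarrow>
     gauss_field M UNIV X \<and> zero_mean M UNIV X \<and> as_continuous M UNIV X \<and>
     (\<forall>s1 t1 s2 t2. cov M (X (s1, t1)) (X (s2, t2)) =
        exp (- (1/2) * \<bar>s2 - s1\<bar> - (1/2) * \<bar>t2 - t1\<bar>))"

definition kiefer_process :: "'a measure \<Rightarrow> (real \<times> real \<Rightarrow> 'a \<Rightarrow> real) \<Rightarrow> bool" where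
  "kiefer_process M K \<longleftrightarrow>
     (\<exists>W. std_wiener_field M W \<and>
        (\<forall>s\<in>{0..1}. \<forall>t\<ge>0. \<forall>\<omega>\<in>space M. K (s, t) \<omega> = W (s, t) \<omega> - s * W (1, t) \<omega>))"

end

theory Submission
  imports Defs
begin

text \<open>
  Substituting \<open>X\<close> into \<open>U\<close> gives \<open>U(s,t) = (1 - s) W(s/(1 - s), t)\<close> for \<open>0 < s < 1\<close>, \<open>t > 0\<close>.
  So \<open>U\<close> is, like the Kiefer process, a linear image of a Wiener field, hence a centred Gauss
  field, and \<open>(1 - s)(1 - s') min (s/(1 - s)) (s'/(1 - s')) = min s s' - s s'\<close> shows that the
  two covariance functions agree (lemma \<open>bridge_min\<close>).

  A centred Gauss field is determined in law, on the product space over the parameter set, by its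
  covariance function (\<open>gauss_field_law_unique\<close>). This needs the Cramer-Wold device in every finite
  dimension; \<open>cramer_wold\<close> reduces it to Levy's uniqueness theorem on the line by
  induction on the dimension. The product law then determines the law on \<open>C(D)\<close>, because the Borel sets
  of \<open>C(D)\<close> are traces of product-measurable sets (\<open>C_borel_subset_cylinder\<close>).

  What remains is the continuity of the paths of \<open>U\<close>. Inside the strip it is clear, but at the side
  \<open>s = 1\<close> it is a strong law of large numbers for \<open>W\<close>. This law is not proved
  directly but read off from the Kiefer process, whose paths are continuous for
  trivial reasons: uniform continuity along the rational points of every bounded part of the
  strip is an event of the product space, so it has probability one for \<open>U\<close> as soon as it has for \<open>K\<close>.
  Since every value of \<open>U\<close> is approximated by values at nearby rational points -- by continuity in
  the interior, and along the sides, where \<open>U\<close> vanishes identically -- it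
  follows that \<open>U\<close> is continuous on the whole strip (\<open>as_continuous_transfer\<close>).
\<close>

section \<open>Cosine integrals and the Cramer-Wold device\<close>

text \<open>Characteristic functions are handled through the real integrals of \<open>cos (b + u X)\<close> with
  an arbitrary phase \<open>b\<close>. They carry the same information, and after adding \<open>1\<close> the integrand is
  a nonnegative function, which can serve as a density.\<close>

lemma (in finite_measure) integrable_cos:
  assumes "f \<in> borel_measurable M"
  shows "integrable M (\<lambda>\<omega>. cos (f \<omega> :: real))"
  using assms by (intro integrable_const_bound[where B = 1]) auto

lemma (in finite_measure) integral_iexp:
  assumes X [measurable]: "X \<in> borel_measurable M"
  shows "(CLINT \<omega>|M. iexp (t * X \<omega>)) =
    Complex (\<integral>\<omega>. cos (t * X \<omega>) \<partial>M) (\<integral>\<omega>. sin (t * X \<omega>) \<partial>M)"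
proof -
  have int: "integrable M (\<lambda>\<omega>. iexp (t * X \<omega>))"
    by (intro integrable_const_bound[where B = 1]) (auto simp flip: of_real_mult)
  show ?thesis
    using integral_Re[OF int] integral_Im[OF int]
    by (intro complex_eqI) (simp_all flip: cis_conv_exp of_real_mult)
qed

text \<open>Levy's uniqueness theorem, stated for finite instead of probability measures. The general
  total mass matters because the induction in the Cramer-Wold device applies it to measures with density.\<close>
lemma distr_eq_if_integral_cos_eq:
  fixes X :: "'a \<Rightarrow> real" and Y :: "'b \<Rightarrow> real"
  assumes "finite_measure M" "finite_measure N"
    and X [measurable]: "X \<in> borel_measurable M" and Y [measurable]: "Y \<in> borel_measurable N"
    and eq: "\<And>b u. (\<integral>\<omega>. cos (b + u * X \<omega>) \<partial>M) = (\<integral>\<omega>. cos (b + u * Y \<omega>) \<partial>N)"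
  shows "distr M borel X = distr N borel Y"
proof -
  interpret M: finite_measure M by fact
  interpret N: finite_measure N by fact
  define m where "m = measure M (space M)"
  have mN: "m = measure N (space N)"
    using eq[of 0 0] by (simp add: m_def)
  show ?thesis
  proof (cases "m = 0")
    case True
    have "emeasure M A = 0" "emeasure N B = 0" for A B
      using True mN m_def emeasure_space[of M A] emeasure_space[of N B]
      by (simp_all add: M.emeasure_eq_measure N.emeasure_eq_measure)
    then show ?thesis by (intro measure_eqI) (simp_all add: emeasure_distr)
  next
    case False
    then have m: "m > 0" by (simp add: m_def zero_less_measure_iff)
    have P_ex: "real_distribution (density (distr M borel X) (\<lambda>_. ennreal (1 / m)))"
      using m by (intro real_distribution.intro real_distribution_axioms.intro prob_spaceI)
        (simp_all add: emeasure_density_const emeasure_distr M.emeasure_eq_measure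
          m_def divide_ennreal flip: ennreal_mult')
    have Q_ex: "real_distribution (density (distr N borel Y) (\<lambda>_. ennreal (1 / m)))"
      using m by (intro real_distribution.intro real_distribution_axioms.intro prob_spaceI)
        (simp_all add: emeasure_density_const emeasure_distr N.emeasure_eq_measure
          mN divide_ennreal flip: ennreal_mult')
    \<comment> \<open>The phase \<open>- pi / 2\<close> turns the cosine integrals into the imaginary part.\<close>
    have sin_shift: "sin x = cos (- pi / 2 + x)" for x :: real
      using cos_add[of "- pi / 2" x] by simp
    have "char (density (distr M borel X) (\<lambda>_. ennreal (1 / m))) t =
          char (density (distr N borel Y) (\<lambda>_. ennreal (1 / m))) t" for t
      unfolding char_def using m eq[of 0 t] eq[of "- pi / 2" t]
      by (simp add: integral_density integral_distr M.integral_iexp N.integral_iexp sin_shift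
          del: of_real_mult)
    then have "char (density (distr M borel X) (\<lambda>_. ennreal (1 / m))) =
          char (density (distr N borel Y) (\<lambda>_. ennreal (1 / m)))"
      by blast
    then have "density (distr M borel X) (\<lambda>_. ennreal (1 / m)) =
        density (distr N borel Y) (\<lambda>_. ennreal (1 / m))"
      by (rule Levy_uniqueness[OF P_ex Q_ex])
    then have "density (density (distr M borel X) (\<lambda>_. ennreal (1 / m))) (\<lambda>_. ennreal m) =
        density (density (distr N borel Y) (\<lambda>_. ennreal (1 / m))) (\<lambda>_. ennreal m)"
      by simp
    then show ?thesis
      using m by (simp add: density_density_eq density_1 flip: ennreal_mult')
  qed
qed

lemma finite_measure_density_bounded:
  assumes "finite_measure M" "f \<in> borel_measurable M" "\<And>x. f x \<le> (B::real)"
  shows "finite_measure (density M (\<lambda>x. ennreal (f x)))"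
proof -
  interpret finite_measure M by fact
  have "(\<integral>\<^sup>+x. ennreal (f x) \<partial>M) \<le> (\<integral>\<^sup>+x. ennreal B \<partial>M)"
    using assms(3) by (intro nn_integral_mono ennreal_leI) auto
  also have "\<dots> < \<infinity>"
    by (simp add: ennreal_mult_less_top emeasure_finite less_top[symmetric] ennreal_mult_eq_top_iff)
  finally show ?thesis
    using assms by (intro finite_measureI) (simp add: emeasure_density cong: nn_integral_cong)
qed

text \<open>The cosine integrals of the pairs \<open>(X, S)\<close> and \<open>(Y, T)\<close> still agree after restriction to
  the events \<open>X \<in> A\<close> and \<open>Y \<in> A\<close>. With \<open>1 + cos (a + S)\<close> as a density, the product formula for
  cosines expresses the cosine integrals of \<open>X\<close> by those of \<open>(X, S)\<close>; so the
  one-dimensional theorem identifies the integrals of the indicator of \<open>A\<close> against this density,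
  and the contribution of the constant \<open>1\<close> is removed by the theorem for \<open>X\<close> itself.\<close>
lemma integral_indicator_cos_eq:
  fixes X S :: "'a \<Rightarrow> real" and Y T :: "'b \<Rightarrow> real"
  assumes fin: "finite_measure M" "finite_measure N"
    and [measurable]: "X \<in> borel_measurable M" "S \<in> borel_measurable M"
      "Y \<in> borel_measurable N" "T \<in> borel_measurable N"
    and eq: "\<And>b u v. (\<integral>\<omega>. cos (b + u * X \<omega> + v * S \<omega>) \<partial>M) = (\<integral>\<omega>. cos (b + u * Y \<omega> + v * T \<omega>) \<partial>N)"
    and A [measurable]: "A \<in> sets borel"
  shows "(\<integral>\<omega>. indicator A (X \<omega>) * cos (a + S \<omega>) \<partial>M) = (\<integral>\<omega>. indicator A (Y \<omega>) * cos (a + T \<omega>) \<partial>N)"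
proof -
  interpret M: finite_measure M by fact
  interpret N: finite_measure N by fact
  have nn: "0 \<le> 1 + cos x" "1 + cos x \<le> 2" for x :: real
    using cos_ge_minus_one[of x] cos_le_one[of x] by linarith+
  have tr: "(1 + cos (a + s)) * cos (b + u * x) = cos (b + u * x + 0 * s)
      + (1/2) * cos (a + b + u * x + 1 * s) + (1/2) * cos (b - a + u * x + (-1) * s)" for b u x s :: real
    using cos_times_cos[of "b + u * x" "a + s"] by (simp add: algebra_simps)
  let ?M = "density M (\<lambda>\<omega>. 1 + cos (a + S \<omega>))" and ?N = "density N (\<lambda>\<omega>. 1 + cos (a + T \<omega>))"
  have "distr ?M borel X = distr ?N borel Y"
  proof (rule distr_eq_if_integral_cos_eq)
    show "finite_measure ?M" "finite_measure ?N"
      by (auto intro!: finite_measure_density_bounded[where B = 2] fin nn)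
    show "(\<integral>\<omega>. cos (b + u * X \<omega>) \<partial>?M) = (\<integral>\<omega>. cos (b + u * Y \<omega>) \<partial>?N)" for b u
      using eq[of b u 0] eq[of "a + b" u 1] eq[of "b - a" u "-1"]
      by (simp add: integral_density nn tr M.integrable_cos N.integrable_cos)
  qed auto
  then have "(\<integral>x. indicator A x \<partial>distr ?M borel X) = (\<integral>x. indicator A x \<partial>distr ?N borel Y :: real)"
    by simp
  then have 1: "(\<integral>\<omega>. (1 + cos (a + S \<omega>)) * indicator A (X \<omega>) \<partial>M) = (\<integral>\<omega>. (1 + cos (a + T \<omega>)) * indicator A (Y \<omega>) \<partial>N)"
    by (subst (asm) (1 2) integral_distr) (simp_all add: integral_density nn)
  have "distr M borel X = distr N borel Y"
    using eq[of _ _ 0] by (intro distr_eq_if_integral_cos_eq fin) auto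
  then have "(\<integral>x. indicator A x \<partial>distr M borel X) = (\<integral>x. indicator A x \<partial>distr N borel Y :: real)"
    by simp
  then have 2: "(\<integral>\<omega>. indicator A (X \<omega>) \<partial>M) = (\<integral>\<omega>. indicator A (Y \<omega>) \<partial>N :: real)"
    by (subst (asm) (1 2) integral_distr) simp_all
  have "integrable M (\<lambda>\<omega>. (1 + cos (a + S \<omega>)) * indicator A (X \<omega>))" "integrable M (\<lambda>\<omega>. indicator A (X \<omega>) :: real)"
    "integrable N (\<lambda>\<omega>. (1 + cos (a + T \<omega>)) * indicator A (Y \<omega>))" "integrable N (\<lambda>\<omega>. indicator A (Y \<omega>) :: real)"
    using nn
    by (auto intro!: M.integrable_const_bound[where B = 2] N.integrable_const_bound[where B = 2]
        simp: indicator_def)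
  from Bochner_Integration.integral_diff[OF this(1,2)] Bochner_Integration.integral_diff[OF this(3,4)]
  show ?thesis using 1 2 by (simp add: algebra_simps)
qed

text \<open>Induction on the index set: one coordinate is moved from the cosine integrals into an
  indicator density, which is why the measures are arbitrary finite ones and vary in the induction.\<close>
lemma cramer_wold:
  fixes X :: "'i \<Rightarrow> 'a \<Rightarrow> real" and Y :: "'i \<Rightarrow> 'b \<Rightarrow> real"
  assumes "finite F" "finite_measure M" "finite_measure N"
    and "\<And>i. i \<in> F \<Longrightarrow> X i \<in> borel_measurable M" "\<And>i. i \<in> F \<Longrightarrow> Y i \<in> borel_measurable N"
    and "\<And>a c. (\<integral>\<omega>. cos (a + (\<Sum>i\<in>F. c i * X i \<omega>)) \<partial>M) = (\<integral>\<omega>. cos (a + (\<Sum>i\<in>F. c i * Y i \<omega>)) \<partial>N)"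
    and "\<And>i. i \<in> F \<Longrightarrow> A i \<in> sets borel"
  shows "measure M {\<omega> \<in> space M. \<forall>i\<in>F. X i \<omega> \<in> A i} = measure N {\<omega> \<in> space N. \<forall>i\<in>F. Y i \<omega> \<in> A i}"
  using assms
proof (induction F arbitrary: M N)
  case empty
  from empty.prems(5)[of 0] show ?case by simp
next
  case (insert k F)
  note fin = insert.prems(1,2)
  interpret M: finite_measure M by fact
  interpret N: finite_measure N by fact
  have [measurable]: "X k \<in> borel_measurable M" "Y k \<in> borel_measurable N"
    "\<And>i. i \<in> F \<Longrightarrow> X i \<in> borel_measurable M" "\<And>i. i \<in> F \<Longrightarrow> Y i \<in> borel_measurable N"
    "A k \<in> sets borel" "\<And>i. i \<in> F \<Longrightarrow> A i \<in> sets borel" "finite F"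
    using insert by auto
  let ?M = "density M (\<lambda>\<omega>. ennreal (indicator (A k) (X k \<omega>)))"
  let ?N = "density N (\<lambda>\<omega>. ennreal (indicator (A k) (Y k \<omega>)))"
  have "measure ?M {\<omega> \<in> space ?M. \<forall>i\<in>F. X i \<omega> \<in> A i} = measure ?N {\<omega> \<in> space ?N. \<forall>i\<in>F. Y i \<omega> \<in> A i}"
  proof (rule insert.IH)
    show "finite_measure ?M" "finite_measure ?N"
      by (auto intro!: finite_measure_density_bounded[where B = 1] fin simp: indicator_def)
    fix a and c :: "'i \<Rightarrow> real"
    have "(\<integral>\<omega>. indicator (A k) (X k \<omega>) * cos (a + (\<Sum>i\<in>F. c i * X i \<omega>)) \<partial>M) =
      (\<integral>\<omega>. indicator (A k) (Y k \<omega>) * cos (a + (\<Sum>i\<in>F. c i * Y i \<omega>)) \<partial>N)"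
    proof (rule integral_indicator_cos_eq[OF fin])
      fix b u v
      have *: "(\<Sum>i\<in>insert k F. (if i = k then u else v * c i) * Z i) = u * Z k + v * (\<Sum>i\<in>F. c i * Z i)" for Z
        using insert.hyps by (simp add: sum_distrib_left mult.assoc) (intro sum.cong, auto)
      show "(\<integral>\<omega>. cos (b + u * X k \<omega> + v * (\<Sum>i\<in>F. c i * X i \<omega>)) \<partial>M) =
         (\<integral>\<omega>. cos (b + u * Y k \<omega> + v * (\<Sum>i\<in>F. c i * Y i \<omega>)) \<partial>N)"
        using insert.prems(5)[of b "\<lambda>i. if i = k then u else v * c i"]
        unfolding * by (simp add: add.assoc)
    qed auto
    then show "(\<integral>\<omega>. cos (a + (\<Sum>i\<in>F. c i * X i \<omega>)) \<partial>?M) = (\<integral>\<omega>. cos (a + (\<Sum>i\<in>F. c i * Y i \<omega>)) \<partial>?N)"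
      by (simp add: integral_density)
  qed auto
  moreover have "measure ?M {\<omega> \<in> space ?M. \<forall>i\<in>F. X i \<omega> \<in> A i} = measure M {\<omega> \<in> space M. \<forall>i\<in>insert k F. X i \<omega> \<in> A i}"
  proof -
    have "emeasure ?M {\<omega> \<in> space ?M. \<forall>i\<in>F. X i \<omega> \<in> A i} = (\<integral>\<^sup>+\<omega>. indicator {\<omega> \<in> space M. \<forall>i\<in>insert k F. X i \<omega> \<in> A i} \<omega> \<partial>M)"
      by (subst emeasure_density) (auto intro!: nn_integral_cong simp del: nn_integral_indicator
          split: split_indicator)
    then show ?thesis by (simp add: measure_def)
  qed
  moreover have "measure ?N {\<omega> \<in> space ?N. \<forall>i\<in>F. Y i \<omega> \<in> A i} = measure N {\<omega> \<in> space N. \<forall>i\<in>insert k F. Y i \<omega> \<in> A i}"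
  proof -
    have "emeasure ?N {\<omega> \<in> space ?N. \<forall>i\<in>F. Y i \<omega> \<in> A i} = (\<integral>\<^sup>+\<omega>. indicator {\<omega> \<in> space N. \<forall>i\<in>insert k F. Y i \<omega> \<in> A i} \<omega> \<partial>N)"
      by (subst emeasure_density) (auto intro!: nn_integral_cong simp del: nn_integral_indicator
          split: split_indicator)
    then show ?thesis by (simp add: measure_def)
  qed
  ultimately show ?case by simp
qed

section \<open>Centred Gauss fields\<close>

lemma (in prob_space) univ_normal_centered:
  assumes "univ_normal M Z" "expectation Z = 0"
  shows "integrable M (\<lambda>\<omega>. (Z \<omega>)\<^sup>2)"
    and "expectation (\<lambda>\<omega>. cos (a + Z \<omega>)) = cos a * exp (- expectation (\<lambda>\<omega>. (Z \<omega>)\<^sup>2) / 2)"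
proof -
  have Z [measurable]: "Z \<in> borel_measurable M"
    using assms by (simp add: univ_normal_def)
  have "integrable M (\<lambda>\<omega>. (Z \<omega>)\<^sup>2) \<and>
    expectation (\<lambda>\<omega>. cos (a + Z \<omega>)) = cos a * exp (- expectation (\<lambda>\<omega>. (Z \<omega>)\<^sup>2) / 2)"
  proof (cases "\<exists>\<mu>. AE \<omega> in M. Z \<omega> = \<mu>")
    case True
    then obtain \<mu> where \<mu>: "AE \<omega> in M. Z \<omega> = \<mu>" by blast
    have "expectation Z = expectation (\<lambda>_. \<mu>)"
      using \<mu> by (intro integral_cong_AE) auto
    then have 0: "AE \<omega> in M. Z \<omega> = 0"
      using \<mu> assms by (simp add: prob_space)
    have "integrable M (\<lambda>\<omega>. (Z \<omega>)\<^sup>2) \<longleftrightarrow> integrable M (\<lambda>_. 0::real)"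
      using 0 by (intro integrable_cong_AE) auto
    moreover have "expectation (\<lambda>\<omega>. (Z \<omega>)\<^sup>2) = expectation (\<lambda>_. 0)"
      using 0 by (intro integral_cong_AE) auto
    moreover have "expectation (\<lambda>\<omega>. cos (a + Z \<omega>)) = expectation (\<lambda>_. cos a)"
      using 0 by (intro integral_cong_AE) auto
    ultimately show ?thesis by (simp add: prob_space)
  next
    case False
    then obtain \<mu> \<sigma> where \<sigma>: "\<sigma> > 0" and D: "distributed M lborel Z (normal_density \<mu> \<sigma>)"
      using assms by (auto simp: univ_normal_def)
    have \<mu>: "\<mu> = 0"
      using normal_distributed_expectation[OF \<sigma> D] assms by simp
    note D = D[unfolded \<mu>]
    have var: "expectation (\<lambda>\<omega>. (Z \<omega>)\<^sup>2) = \<sigma>\<^sup>2"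
      using normal_distributed_variance[OF \<sigma> D] assms by simp
    have int: "integrable M (\<lambda>\<omega>. (Z \<omega>)\<^sup>2)"
      using integrable_normal_moment[OF \<sigma>, of 0 2]
        distributed_integrable[OF D, of "\<lambda>x. x\<^sup>2"] by simp
    have dS: "distributed M lborel (\<lambda>\<omega>. Z \<omega> / \<sigma>) std_normal_density"
      using D normal_standard_normal_convert[OF \<sigma>, of Z 0] by simp
    have eqd: "distr M borel (\<lambda>\<omega>. Z \<omega> / \<sigma>) = std_normal_distribution"
      using distributed_distr_eq_density[OF dS] by (simp cong: distr_cong)
    have "char (distr M borel (\<lambda>\<omega>. Z \<omega> / \<sigma>)) \<sigma> = exp (- \<sigma>\<^sup>2 / 2)"
      unfolding eqd char_std_normal_distribution by simp
    then have "(CLINT \<omega>|M. iexp (1 * Z \<omega>)) = exp (- \<sigma>\<^sup>2 / 2)"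
      using \<sigma> by (simp add: char_def integral_distr)
    from this[unfolded integral_iexp[OF Z]]
    have c: "expectation (\<lambda>\<omega>. cos (Z \<omega>)) = exp (- \<sigma>\<^sup>2 / 2)" 
      and s: "expectation (\<lambda>\<omega>. sin (Z \<omega>)) = 0"
      by (simp_all add: complex_eq_iff)
    have "integrable M (\<lambda>\<omega>. sin (Z \<omega>))"
      by (intro integrable_const_bound[where B = 1]) auto
    then have "expectation (\<lambda>\<omega>. cos (a + Z \<omega>)) = cos a * exp (- \<sigma>\<^sup>2 / 2)"
      using c s integrable_cos[OF Z] by (simp add: cos_add)
    then show ?thesis using var int by simp
  qed
  then show "integrable M (\<lambda>\<omega>. (Z \<omega>)\<^sup>2)"
    "expectation (\<lambda>\<omega>. cos (a + Z \<omega>)) = cos a * exp (- expectation (\<lambda>\<omega>. (Z \<omega>)\<^sup>2) / 2)"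
    by auto
qed

lemma gauss_fieldD:
  assumes "gauss_field M D Y" "zero_mean M D Y" "finite F" "F \<subseteq> D"
  shows "prob_space M" "univ_normal M (\<lambda>\<omega>. \<Sum>p\<in>F. c p * Y p \<omega>)"
    "(\<integral>\<omega>. (\<Sum>p\<in>F. c p * Y p \<omega>) \<partial>M) = 0"
proof -
  show "prob_space M" "univ_normal M (\<lambda>\<omega>. \<Sum>p\<in>F. c p * Y p \<omega>)"
    using assms unfolding gauss_field_def multi_normal_def by blast+
  have "integrable M (Y p)" "(\<integral>\<omega>. Y p \<omega> \<partial>M) = 0" if "p \<in> F" for p
    using assms that unfolding zero_mean_def by blast+
  then show "(\<integral>\<omega>. (\<Sum>p\<in>F. c p * Y p \<omega>) \<partial>M) = 0"
    by (simp add: Bochner_Integration.integral_sum)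
qed

lemma gauss_field_measurable:
  assumes "gauss_field M D Y" "p \<in> D"
  shows "Y p \<in> borel_measurable M"
proof -
  have "multi_normal M {p} Y" using assms by (simp add: gauss_field_def)
  then show ?thesis by (simp add: multi_normal_def)
qed

lemma gauss_field_integrable_mult:
  assumes G: "gauss_field M D Y" "zero_mean M D Y" and D: "p \<in> D" "q \<in> D"
  shows "integrable M (\<lambda>\<omega>. Y p \<omega> * Y q \<omega>)"
proof -
  note meas = gauss_field_measurable[OF G(1)]
  have sq: "integrable M (\<lambda>\<omega>. (Y r \<omega>)\<^sup>2)" if "r \<in> D" for r
    using gauss_fieldD(1)[OF G, of "{r}"] gauss_fieldD(2,3)[OF G, of "{r}" "\<lambda>_. 1"] that
      prob_space.univ_normal_centered(1)[of M "Y r"] by simp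
  show ?thesis
  proof (rule Bochner_Integration.integrable_bound)
    show "integrable M (\<lambda>\<omega>. (Y p \<omega>)\<^sup>2 + (Y q \<omega>)\<^sup>2)" using sq D by simp
    have "\<bar>x * y\<bar> \<le> x\<^sup>2 + y\<^sup>2" for x y :: real
    proof -
      have "2 * \<bar>x * y\<bar> \<le> x\<^sup>2 + y\<^sup>2"
        using sum_squares_bound[of "\<bar>x\<bar>" "\<bar>y\<bar>"] by (simp add: abs_mult mult.assoc)
      then show ?thesis by simp
    qed
    then show "AE \<omega> in M. norm (Y p \<omega> * Y q \<omega>) \<le> norm ((Y p \<omega>)\<^sup>2 + (Y q \<omega>)\<^sup>2)"
      by (intro AE_I2) (metis abs_of_nonneg real_norm_def sum_power2_ge_zero)
    show "(\<lambda>\<omega>. Y p \<omega> * Y q \<omega>) \<in> borel_measurable M"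
      using meas D by (intro borel_measurable_times) auto
  qed
qed

lemma zero_mean_cov:
  assumes "zero_mean M D Y" "p \<in> D" "q \<in> D"
  shows "cov M (Y p) (Y q) = (\<integral>\<omega>. Y p \<omega> * Y q \<omega> \<partial>M)"
proof -
  have "(\<integral>\<omega>. Y p \<omega> \<partial>M) = 0" "(\<integral>\<omega>. Y q \<omega> \<partial>M) = 0"
    using assms unfolding zero_mean_def by blast+
  then show ?thesis by (simp add: cov_def)
qed

lemma zero_mean_cov_sum:
  assumes G: "gauss_field M D Y" "zero_mean M D Y"
    and "finite F" "F \<subseteq> D" "finite F'" "F' \<subseteq> D"
  shows "cov M (\<lambda>\<omega>. \<Sum>p\<in>F. c p * Y p \<omega>) (\<lambda>\<omega>. \<Sum>q\<in>F'. d q * Y q \<omega>) =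
    (\<Sum>p\<in>F. \<Sum>q\<in>F'. c p * d q * cov M (Y p) (Y q))"
proof -
  have "(\<Sum>p\<in>F. c p * Y p \<omega>) * (\<Sum>q\<in>F'. d q * Y q \<omega>) =
      (\<Sum>p\<in>F. \<Sum>q\<in>F'. c p * d q * (Y p \<omega> * Y q \<omega>))" for \<omega>
    unfolding sum_product by (intro sum.cong refl) (simp add: mult_ac)
  moreover have "integrable M (\<lambda>\<omega>. Y p \<omega> * Y q \<omega>)" if "p \<in> F" "q \<in> F'" for p q
    using that assms by (intro gauss_field_integrable_mult[OF G]) auto
  ultimately have "(\<integral>\<omega>. (\<Sum>p\<in>F. c p * Y p \<omega>) * (\<Sum>q\<in>F'. d q * Y q \<omega>) \<partial>M) =
      (\<Sum>p\<in>F. \<Sum>q\<in>F'. c p * d q * (\<integral>\<omega>. Y p \<omega> * Y q \<omega> \<partial>M))"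
    by (simp add: Bochner_Integration.integral_sum)
  also have "\<dots> = (\<Sum>p\<in>F. \<Sum>q\<in>F'. c p * d q * cov M (Y p) (Y q))"
    using assms by (intro sum.cong refl) (simp add: zero_mean_cov[OF G(2)] subsetD)
  finally show ?thesis
    using gauss_fieldD(3)[OF G] assms by (simp add: cov_def)
qed

lemma gauss_field_integral_cos:
  assumes G: "gauss_field M D Y" "zero_mean M D Y" and F: "finite F" "F \<subseteq> D"
  shows "(\<integral>\<omega>. cos (a + (\<Sum>p\<in>F. c p * Y p \<omega>)) \<partial>M) =
    cos a * exp (- (\<Sum>p\<in>F. \<Sum>q\<in>F. c p * c q * cov M (Y p) (Y q)) / 2)"
proof -
  note D = gauss_fieldD(1)[OF G F] gauss_fieldD(2,3)[OF G F, of c]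
  have "cov M (\<lambda>\<omega>. \<Sum>p\<in>F. c p * Y p \<omega>) (\<lambda>\<omega>. \<Sum>p\<in>F. c p * Y p \<omega>) =
      (\<integral>\<omega>. (\<Sum>p\<in>F. c p * Y p \<omega>)\<^sup>2 \<partial>M)"
    by (simp add: cov_def D(3) power2_eq_square)
  then show ?thesis
    using prob_space.univ_normal_centered(2)[OF D] zero_mean_cov_sum[OF G F F] by simp
qed

lemma restrict_vimage_prod_emb:
  assumes "J \<subseteq> D"
  shows "(\<lambda>\<omega>. \<lambda>p\<in>D. V p \<omega>) -` prod_emb D (\<lambda>_. borel) J (Pi\<^sub>E J A) \<inter> \<Omega> =
    {\<omega> \<in> \<Omega>. \<forall>p\<in>J. V p \<omega> \<in> A p}"
  using subsetD[OF assms] by (auto simp: prod_emb_def PiE_iff)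

text \<open>All cosine integrals of finite linear combinations are functions of the covariances, so
  the Cramer-Wold device gives equal finite-dimensional distributions.\<close>
lemma gauss_field_law_unique:
  assumes Y: "gauss_field M D Y" "zero_mean M D Y" and Z: "gauss_field N D Z" "zero_mean N D Z"
    and cov: "\<And>p q. p \<in> D \<Longrightarrow> q \<in> D \<Longrightarrow> cov M (Y p) (Y q) = cov N (Z p) (Z q)"
  shows "distr M (\<Pi>\<^sub>M p\<in>D. borel) (\<lambda>\<omega>. \<lambda>p\<in>D. Y p \<omega>) = distr N (\<Pi>\<^sub>M p\<in>D. borel) (\<lambda>\<omega>. \<lambda>p\<in>D. Z p \<omega>)"
    (is "?P = ?Q")
proof (rule measure_eqI_PiM_infinite)
  interpret M: prob_space M using Y by (simp add: gauss_field_def)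
  interpret N: prob_space N using Z by (simp add: gauss_field_def)
  note [measurable] = gauss_field_measurable[OF Y(1)] gauss_field_measurable[OF Z(1)]
  have mY [measurable]: "(\<lambda>\<omega>. \<lambda>p\<in>D. Y p \<omega>) \<in> M \<rightarrow>\<^sub>M (\<Pi>\<^sub>M p\<in>D. borel)"
    and mZ [measurable]: "(\<lambda>\<omega>. \<lambda>p\<in>D. Z p \<omega>) \<in> N \<rightarrow>\<^sub>M (\<Pi>\<^sub>M p\<in>D. borel)"
    by (auto intro!: measurable_restrict)
  show "finite_measure ?P"
    by (intro M.finite_measure_distr mY)
  fix A :: "real \<times> real \<Rightarrow> real set" and J assume J: "finite J" "J \<subseteq> D" and A: "\<And>i. i \<in> J \<Longrightarrow> A i \<in> sets borel"
  have "measure M {\<omega> \<in> space M. \<forall>p\<in>J. Y p \<omega> \<in> A p} = measure N {\<omega> \<in> space N. \<forall>p\<in>J. Z p \<omega> \<in> A p}"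
  proof (rule cramer_wold[OF J(1)])
    fix a c
    have "(\<Sum>p\<in>J. \<Sum>q\<in>J. c p * c q * cov M (Y p) (Y q)) =
        (\<Sum>p\<in>J. \<Sum>q\<in>J. c p * c q * cov N (Z p) (Z q))"
      using J by (intro sum.cong refl) (simp add: cov subsetD)
    then show "(\<integral>\<omega>. cos (a + (\<Sum>p\<in>J. c p * Y p \<omega>)) \<partial>M) = (\<integral>\<omega>. cos (a + (\<Sum>p\<in>J. c p * Z p \<omega>)) \<partial>N)"
      using gauss_field_integral_cos[OF Y J] gauss_field_integral_cos[OF Z J] by simp
  qed (use J A in \<open>auto intro: M.finite_measure_axioms N.finite_measure_axioms\<close>)
  then show "?P (prod_emb D (\<lambda>_. borel) J (Pi\<^sub>E J A)) = ?Q (prod_emb D (\<lambda>_. borel) J (Pi\<^sub>E J A))"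
    using J A by (subst (1 2) emeasure_distr)
      (auto simp: restrict_vimage_prod_emb[OF J(2)] M.emeasure_eq_measure N.emeasure_eq_measure intro!: sets_PiM_I)
qed simp_all

text \<open>The hypothesis on \<open>Z\<close> is confined to \<open>space M\<close> because the definition of a Kiefer process
  specifies its values only there.\<close>
lemma gauss_field_linear:
  assumes G: "gauss_field M D Y" "zero_mean M D Y"
    and J: "\<And>p. p \<in> D' \<Longrightarrow> finite (J p) \<and> J p \<subseteq> D"
    and Z: "\<And>p \<omega>. p \<in> D' \<Longrightarrow> \<omega> \<in> space M \<Longrightarrow> Z p \<omega> = (\<Sum>q\<in>J p. a p q * Y q \<omega>)"
  shows "gauss_field M D' Z" "zero_mean M D' Z"
    "\<And>p q. p \<in> D' \<Longrightarrow> q \<in> D' \<Longrightarrow>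
       cov M (Z p) (Z q) = (\<Sum>i\<in>J p. \<Sum>j\<in>J q. a p i * a q j * cov M (Y i) (Y j))"
proof -
  interpret prob_space M using G by (simp add: gauss_field_def)
  have int: "integrable M (Y p)" "(\<integral>\<omega>. Y p \<omega> \<partial>M) = 0" if "p \<in> D" for p
    using G that by (auto simp: zero_mean_def)
  have meas: "Z p \<in> borel_measurable M" if "p \<in> D'" for p
  proof -
    have "(\<lambda>\<omega>. \<Sum>q\<in>J p. a p q * Y q \<omega>) \<in> borel_measurable M"
      using J[OF that] gauss_field_measurable[OF G(1)]
      by (intro borel_measurable_sum borel_measurable_times) auto
    then show ?thesis using Z[OF that] by (simp cong: measurable_cong)
  qed
  have cong: "univ_normal M f \<longleftrightarrow> univ_normal M g" if "\<And>\<omega>. \<omega> \<in> space M \<Longrightarrow> f \<omega> = g \<omega>" for f g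
    using that unfolding univ_normal_def distributed_def
    by (simp cong: measurable_cong distr_cong AE_cong_simp)
  have "univ_normal M (\<lambda>\<omega>. \<Sum>p\<in>F. c p * Z p \<omega>)" if F: "finite F" "F \<subseteq> D'" for F c
  proof -
    define H where "H = (\<Union>p\<in>F. J p)"
    have H: "finite H" "H \<subseteq> D" "\<And>p. p \<in> F \<Longrightarrow> J p \<subseteq> H" using J F by (auto simp: H_def)
    have "(\<Sum>p\<in>F. c p * Z p \<omega>) =
        (\<Sum>q\<in>H. (\<Sum>p\<in>F. c p * (if q \<in> J p then a p q else 0)) * Y q \<omega>)"
      if "\<omega> \<in> space M" for \<omega>
    proof -
      have "(\<Sum>p\<in>F. c p * Z p \<omega>) = (\<Sum>p\<in>F. \<Sum>q\<in>H. c p * (if q \<in> J p then a p q else 0) * Y q \<omega>)"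
      proof (intro sum.cong refl)
        fix p assume p: "p \<in> F"
        have "c p * Z p \<omega> = (\<Sum>q\<in>J p. c p * (if q \<in> J p then a p q else 0) * Y q \<omega>)"
          using p subsetD[OF F(2)] that by (simp add: Z sum_distrib_left mult.assoc)
        also have "\<dots> = (\<Sum>q\<in>H. c p * (if q \<in> J p then a p q else 0) * Y q \<omega>)"
          using H p by (intro sum.mono_neutral_left) auto
        finally show "c p * Z p \<omega> = (\<Sum>q\<in>H. c p * (if q \<in> J p then a p q else 0) * Y q \<omega>)" .
      qed
      also have "\<dots> = (\<Sum>q\<in>H. \<Sum>p\<in>F. c p * (if q \<in> J p then a p q else 0) * Y q \<omega>)"
        by (rule sum.swap)
      finally show ?thesis by (simp add: sum_distrib_right)
    qed
    then show ?thesis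
      by (rule iffD2[OF cong gauss_fieldD(2)[OF G H(1,2)]])
  qed
  then show "gauss_field M D' Z"
    using meas by (auto simp: gauss_field_def multi_normal_def prob_space_axioms)
  have Zint: "(\<integral>\<omega>. Z p \<omega> \<partial>M) = (\<integral>\<omega>. (\<Sum>q\<in>J p. a p q * Y q \<omega>) \<partial>M)"
    "integrable M (Z p) \<longleftrightarrow> integrable M (\<lambda>\<omega>. \<Sum>q\<in>J p. a p q * Y q \<omega>)" if "p \<in> D'" for p
    using Z[OF that]
    by (auto intro!: Bochner_Integration.integral_cong Bochner_Integration.integrable_cong)
  then show "zero_mean M D' Z"
    unfolding zero_mean_def
  proof (intro ballI)
    fix p assume p: "p \<in> D'"
    have "integrable M (Y q)" "(\<integral>\<omega>. Y q \<omega> \<partial>M) = 0" if "q \<in> J p" for q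
      using int J[OF p] that by blast+
    then show "integrable M (Z p) \<and> expectation (Z p) = 0"
      by (simp add: Zint[OF p] Bochner_Integration.integral_sum)
  qed
  show "cov M (Z p) (Z q) = (\<Sum>i\<in>J p. \<Sum>j\<in>J q. a p i * a q j * cov M (Y i) (Y j))"
    if "p \<in> D'" "q \<in> D'" for p q
  proof -
    have "cov M (Z p) (Z q) = cov M (\<lambda>\<omega>. \<Sum>i\<in>J p. a p i * Y i \<omega>) (\<lambda>\<omega>. \<Sum>i\<in>J q. a q i * Y i \<omega>)"
      unfolding cov_def Zint(1)[OF that(1)] Zint(1)[OF that(2)]
      using Z that by (intro Bochner_Integration.integral_cong) auto
    then show ?thesis
      using zero_mean_cov_sum[OF G, of "J p" "J q" "a p" "a q"] J that by simp
  qed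
qed

section \<open>Laws on the space of continuous functions\<close>

text \<open>With \<open>B\<close> from a countable base and rational bounds \<open>l\<close> and \<open>u\<close> there are only countably many of these
  sets. They form a countable network for the topology of \<open>C(D)\<close>: they need not be open, but every
  open set is a union of some of them.\<close>
definition C_band ::
    "(real \<times> real) set \<Rightarrow> ((real \<times> real) set \<times> real \<times> real) set \<Rightarrow> (real \<times> real \<Rightarrow> real) set" where
  "C_band D \<theta> = {g \<in> C_space D. \<forall>(B, l, u)\<in>\<theta>. \<forall>p\<in>B \<inter> D. g p \<in> {l..u}}"

text \<open>Since \<open>B\<close> is open, a continuous function satisfies the bounds on all of \<open>B \<inter> D\<close> if it does
  on a countable dense part, so only countably many evaluations are involved.\<close>
lemma C_band_in_sets:
  assumes fin: "finite \<theta>" and op: "\<And>B l u. (B, l, u) \<in> \<theta> \<Longrightarrow> open B"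
  shows "C_band D \<theta> \<in> sets (restrict_space (\<Pi>\<^sub>M p\<in>D. borel) (C_space D))" (is "_ \<in> sets ?R")
proof -
  obtain Q where Q: "countable Q" "Q \<subseteq> D" "D \<subseteq> closure Q"
    using separable[of D] by blast
  have sp: "space ?R = C_space D"
    by (auto simp: space_restrict_space space_PiM C_space_def PiE_def)
  have *: "(\<forall>p\<in>B \<inter> D. g p \<in> {l..u}) \<longleftrightarrow> (\<forall>p\<in>B \<inter> Q. g p \<in> {l..u})"
    if "(B, l, u) \<in> \<theta>" "g \<in> C_space D" for B l u g
  proof
    assume le: "\<forall>p\<in>B \<inter> Q. g p \<in> {l..u}"
    have B: "open B" using op that(1) by blast
    have "B \<inter> D \<subseteq> closure (B \<inter> Q)"
      using open_Int_closure_subset[OF B, of Q] Q(3) by blast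
    moreover have "continuous_on D g"
      using that(2) by (auto simp: C_space_def)
    ultimately show "\<forall>p\<in>B \<inter> D. g p \<in> {l..u}"
    proof (intro ballI)
      fix p assume *: "B \<inter> D \<subseteq> closure (B \<inter> Q)" "continuous_on D g" and p: "p \<in> B \<inter> D"
      then obtain x where x: "\<And>n. x n \<in> B \<inter> Q" "x \<longlonglongrightarrow> p"
        by (meson closure_sequential subsetD)
      have "(\<lambda>n. g (x n)) \<longlonglongrightarrow> g p"
        using x(1) p Q(2) by (intro continuous_on_tendsto_compose[OF *(2) x(2)] always_eventually) auto
      moreover have "g (x n) \<in> {l..u}" for n using le x(1) by blast
      ultimately show "g p \<in> {l..u}"
        using closed_sequentially[of "{l..u}" "\<lambda>n. g (x n)"] by blast
    qed
  qed (use Q in blast)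
  have ev: "(\<lambda>g. g p) \<in> ?R \<rightarrow>\<^sub>M borel" if "p \<in> D" for p
    using that by (intro measurable_restrict_space1 measurable_component_singleton)
  have "C_band D \<theta> = {g \<in> space ?R. \<forall>i\<in>\<theta>. \<forall>p\<in>fst i \<inter> Q. g p \<in> {fst (snd i)..snd (snd i)}}"
  proof -
    have "(\<forall>(B, l, u)\<in>\<theta>. \<forall>p\<in>B \<inter> D. g p \<in> {l..u}) \<longleftrightarrow>
        (\<forall>i\<in>\<theta>. \<forall>p\<in>fst i \<inter> Q. g p \<in> {fst (snd i)..snd (snd i)})" if "g \<in> C_space D" for g
      unfolding split_beta
    proof (rule ball_cong[OF refl])
      fix i assume "i \<in> \<theta>"
      then show "(\<forall>p\<in>fst i \<inter> D. g p \<in> {fst (snd i)..snd (snd i)}) \<longleftrightarrow>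
          (\<forall>p\<in>fst i \<inter> Q. g p \<in> {fst (snd i)..snd (snd i)})"
        using that by (intro *) simp_all
    qed
    then show ?thesis unfolding sp C_band_def by blast
  qed
  also have "\<dots> \<in> sets ?R"
  proof (intro sets.sets_Collect_countable_All')
    fix i p assume "i \<in> \<theta>" "p \<in> fst i \<inter> Q"
    then have "p \<in> D" using Q(2) by blast
    then show "{g \<in> space ?R. g p \<in> {fst (snd i)..snd (snd i)}} \<in> sets ?R"
      by (rule measurable_sets_Collect[OF ev]) simp
  qed (use Q(1) fin in \<open>simp_all add: countable_finite\<close>)
  finally show ?thesis .
qed

lemma C_open_subset: "C_open D V \<Longrightarrow> V \<subseteq> C_space D"
  by (simp add: C_open_def)

text \<open>Around a function \<open>f\<close> in \<open>V\<close>, each point of the compact set \<open>K\<close> has a basic neighbourhood on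
  which \<open>f\<close> lies in a rational interval shorter than \<open>e\<close>; finitely many of them cover \<open>K\<close>, and any
  function within the same bounds differs from \<open>f\<close> by less than \<open>e\<close> on \<open>K\<close>.\<close>
lemma C_open_eq_Union_C_band:
  assumes V: "C_open D V" and \<B>: "topological_basis \<B>"
  shows "V = (\<Union>\<theta>\<in>{\<theta> \<in> {\<theta>. finite \<theta> \<and> \<theta> \<subseteq> \<B> \<times> \<rat> \<times> \<rat>}. C_band D \<theta> \<subseteq> V}. C_band D \<theta>)"
proof (intro equalityI subsetI)
  fix f assume f: "f \<in> V"
  have "\<exists>K e. compact K \<and> K \<subseteq> D \<and> e > 0 \<and>
      (\<forall>g\<in>C_space D. (\<forall>p\<in>K. \<bar>g p - f p\<bar> < e) \<longrightarrow> g \<in> V)"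
    using V f unfolding C_open_def by (elim conjE) (erule bspec)
  then obtain K e where K: "compact K" "K \<subseteq> D" and e: "e > 0"
    and Ve': "\<forall>g\<in>C_space D. (\<forall>p\<in>K. \<bar>g p - f p\<bar> < e) \<longrightarrow> g \<in> V"
    by (elim exE conjE)
  have Ve: "g \<in> V" if "g \<in> C_space D" "\<And>p. p \<in> K \<Longrightarrow> \<bar>g p - f p\<bar> < e" for g
    using Ve' that by blast
  have fC: "f \<in> C_space D" "continuous_on D f"
    using C_open_subset[OF V] f by (auto simp: C_space_def)
  have "\<exists>i. i \<in> \<B> \<times> \<rat> \<times> \<rat> \<and> p \<in> fst i \<and> snd (snd i) - fst (snd i) < e \<and>
      (\<forall>q\<in>fst i \<inter> D. f q \<in> {fst (snd i)..snd (snd i)})" if p: "p \<in> K" for p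
  proof -
    obtain l where l: "l \<in> \<rat>" "f p - e / 2 < l" "l < f p"
      using Rats_dense_in_real[of "f p - e / 2" "f p"] e by auto
    obtain u where u: "u \<in> \<rat>" "f p < u" "u < f p + e / 2"
      using Rats_dense_in_real[of "f p" "f p + e / 2"] e by auto
    have "p \<in> D" "f p \<in> {l<..<u}" using p K l u by auto
    then obtain A where A: "open A" "p \<in> A" "\<And>q. q \<in> D \<Longrightarrow> q \<in> A \<Longrightarrow> f q \<in> {l<..<u}"
      using fC(2)[unfolded continuous_on_topological, rule_format, OF _ open_greaterThanLessThan]
      by meson
    obtain B where B: "B \<in> \<B>" "p \<in> B" "B \<subseteq> A"
      by (rule topological_basisE[OF \<B> A(1,2)])
    have "f q \<in> {l..u}" if "q \<in> B \<inter> D" for q using A(3)[of q] that B(3) by auto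
    with B l u show ?thesis by (intro exI[of _ "(B, l, u)"]) simp
  qed
  then obtain i where i: "\<And>p. p \<in> K \<Longrightarrow> i p \<in> \<B> \<times> \<rat> \<times> \<rat> \<and> p \<in> fst (i p) \<and>
      snd (snd (i p)) - fst (snd (i p)) < e \<and> (\<forall>q\<in>fst (i p) \<inter> D. f q \<in> {fst (snd (i p))..snd (snd (i p))})"
    by metis
  have "open (fst (i p))" if "p \<in> K" for p
    using i[OF that] by (intro topological_basis_open[OF \<B>]) auto
  moreover have "K \<subseteq> (\<Union>p\<in>K. fst (i p))" using i by blast
  ultimately obtain K' where K': "K' \<subseteq> K" "finite K'" "K \<subseteq> (\<Union>p\<in>K'. fst (i p))"
    by (rule compactE_image[OF K(1)])
  define \<theta> where "\<theta> = i ` K'"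
  have "f \<in> C_band D \<theta>"
    unfolding C_band_def \<theta>_def split_beta using fC(1) i K'(1) by blast
  moreover have "finite \<theta>" "\<theta> \<subseteq> \<B> \<times> \<rat> \<times> \<rat>"
    unfolding \<theta>_def using i K' by blast+
  moreover have "C_band D \<theta> \<subseteq> V"
  proof
    fix g assume g: "g \<in> C_band D \<theta>"
    have "\<bar>g q - f q\<bar> < e" if q: "q \<in> K" for q
    proof -
      obtain p where p: "p \<in> K'" "q \<in> fst (i p)" using K' q by blast
      have "g q \<in> {fst (snd (i p))..snd (snd (i p))}"
        using g p q K unfolding C_band_def \<theta>_def split_beta by blast
      moreover have "f q \<in> {fst (snd (i p))..snd (snd (i p))}" "snd (snd (i p)) - fst (snd (i p)) < e"
        using i[of p] p q K K' by blast+
      ultimately show ?thesis by auto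
    qed
    then show "g \<in> V" using g by (intro Ve) (simp_all add: C_band_def)
  qed
  ultimately show "f \<in> (\<Union>\<theta>\<in>{\<theta> \<in> {\<theta>. finite \<theta> \<and> \<theta> \<subseteq> \<B> \<times> \<rat> \<times> \<rat>}. C_band D \<theta> \<subseteq> V}. C_band D \<theta>)"
    by blast
qed blast

lemma C_borel_subset_cylinder:
  "sets (C_borel D) \<subseteq> sets (restrict_space (\<Pi>\<^sub>M p\<in>D. borel) (C_space D))" (is "_ \<subseteq> sets ?R")
proof -
  obtain \<B> :: "(real \<times> real) set set" where \<B>: "countable \<B>" "topological_basis \<B>"
    using ex_countable_basis by blast
  have "countable {\<theta>. finite \<theta> \<and> \<theta> \<subseteq> \<B> \<times> (\<rat> :: real set) \<times> (\<rat> :: real set)}"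
    using \<B>(1) countable_rat by (intro countable_Collect_finite_subset countable_SIGMA)
  then have *: "countable {\<theta> \<in> {\<theta>. finite \<theta> \<and> \<theta> \<subseteq> \<B> \<times> (\<rat> :: real set) \<times> (\<rat> :: real set)}. C_band D \<theta> \<subseteq> V}" for V
    by (rule countable_subset[rotated]) blast
  have "(\<Union>\<theta>\<in>{\<theta> \<in> {\<theta>. finite \<theta> \<and> \<theta> \<subseteq> \<B> \<times> \<rat> \<times> \<rat>}. C_band D \<theta> \<subseteq> V}. C_band D \<theta>) \<in> sets ?R" for V
  proof (rule sets.countable_UN''[OF *])
    fix \<theta> assume "\<theta> \<in> {\<theta> \<in> {\<theta>. finite \<theta> \<and> \<theta> \<subseteq> \<B> \<times> \<rat> \<times> \<rat>}. C_band D \<theta> \<subseteq> V}"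
    then show "C_band D \<theta> \<in> sets ?R"
      using topological_basis_open[OF \<B>(2)] by (intro C_band_in_sets) blast+
  qed
  then have "V \<in> sets ?R" if "C_open D V" for V
    by (subst C_open_eq_Union_C_band[OF that \<B>(2)])
  moreover have "C_space D \<in> sets ?R"
    using sets.top[of ?R] by (simp add: space_restrict_space space_PiM C_space_def PiE_def Int_absorb2)
  ultimately show ?thesis
    unfolding C_borel_def
    using C_open_subset by (intro iffD2[OF sigma_le_sets] conjI) blast+
qed

lemma sample_path_in_C_space: "sample_path D Y \<omega> \<in> C_space D"
proof -
  have *: "continuous_on D (\<lambda>p\<in>D. h p)" if "continuous_on D h" for h :: "real \<times> real \<Rightarrow> real"
    using that by (rule continuous_on_eq) simp
  show ?thesis
    unfolding sample_path_def C_space_def by (simp add: * restrict_extensional)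
qed

text \<open>The sample path agrees almost surely with the restriction of \<open>Y\<close>, a measurable map into the
  product space; completeness makes the exceptional null set harmless.\<close>
lemma
  assumes cont: "as_continuous M D Y" and meas: "\<And>p. p \<in> D \<Longrightarrow> Y p \<in> borel_measurable M"
  shows sample_path_measurable: "sample_path D Y \<in> completion M \<rightarrow>\<^sub>M C_borel D"
    and emeasure_law_on_C: "V \<in> sets (C_borel D) \<Longrightarrow> A \<in> sets (\<Pi>\<^sub>M p\<in>D. borel) \<Longrightarrow>
      V = C_space D \<inter> A \<Longrightarrow>
      emeasure (law_on_C M D Y) V = emeasure (distr M (\<Pi>\<^sub>M p\<in>D. borel) (\<lambda>\<omega>. \<lambda>p\<in>D. Y p \<omega>)) A"
proof -
  have m: "(\<lambda>\<omega>. \<lambda>p\<in>D. Y p \<omega>) \<in> M \<rightarrow>\<^sub>M (\<Pi>\<^sub>M p\<in>D. borel)"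
    using meas by (intro measurable_restrict)
  have sp: "space (C_borel D) = C_space D"
    by (simp add: C_borel_def space_measure_of_conv)
  have ae: "AE \<omega> in completion M. \<omega> \<in> (\<lambda>\<omega>. \<lambda>p\<in>D. Y p \<omega>) -` A \<inter> space M \<longleftrightarrow>
      \<omega> \<in> sample_path D Y -` (C_space D \<inter> A) \<inter> space M" for A
    using AE_completion[OF cont[unfolded as_continuous_def]]
  proof eventually_elim
    case (elim \<omega>)
    then have "sample_path D Y \<omega> = (\<lambda>p\<in>D. Y p \<omega>)" by (simp add: sample_path_def)
    then show ?case using sample_path_in_C_space[of D Y \<omega>] by auto
  qed
  have in_sets: "sample_path D Y -` (C_space D \<inter> A) \<inter> space M \<in> sets (completion M)"
    if "A \<in> sets (\<Pi>\<^sub>M p\<in>D. borel)" for A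
    using completion.in_sets_AE[OF ae] measurable_sets[OF m that] by auto
  show sm: "sample_path D Y \<in> completion M \<rightarrow>\<^sub>M C_borel D"
  proof (rule measurableI)
    fix V assume "V \<in> sets (C_borel D)"
    then obtain A where "A \<in> sets (\<Pi>\<^sub>M p\<in>D. borel)" "V = C_space D \<inter> A"
      using C_borel_subset_cylinder[of D] by (auto simp: sets_restrict_space)
    then show "sample_path D Y -` V \<inter> space (completion M) \<in> sets (completion M)"
      using in_sets by simp
  qed (simp add: sp sample_path_in_C_space)
  assume V: "V \<in> sets (C_borel D)" and A: "A \<in> sets (\<Pi>\<^sub>M p\<in>D. borel)" "V = C_space D \<inter> A"
  have "emeasure (law_on_C M D Y) V = emeasure (completion M) (sample_path D Y -` V \<inter> space M)"
    unfolding law_on_C_def by (subst emeasure_distr[OF sm V]) simp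
  also have "\<dots> = emeasure (completion M) ((\<lambda>\<omega>. \<lambda>p\<in>D. Y p \<omega>) -` A \<inter> space M)"
    using ae[of A] in_sets[OF A(1)] measurable_sets[OF m A(1)] unfolding A(2)
    by (intro emeasure_eq_AE) auto
  also have "\<dots> = emeasure (distr M (\<Pi>\<^sub>M p\<in>D. borel) (\<lambda>\<omega>. \<lambda>p\<in>D. Y p \<omega>)) A"
    using measurable_sets[OF m A(1)] by (simp add: emeasure_distr[OF m A(1)])
  finally show "emeasure (law_on_C M D Y) V =
    emeasure (distr M (\<Pi>\<^sub>M p\<in>D. borel) (\<lambda>\<omega>. \<lambda>p\<in>D. Y p \<omega>)) A" .
qed

lemma same_law_on_CI:
  assumes "as_continuous M D Y" "as_continuous N D Z"
    and "\<And>p. p \<in> D \<Longrightarrow> Y p \<in> borel_measurable M" "\<And>p. p \<in> D \<Longrightarrow> Z p \<in> borel_measurable N"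
    and eq: "distr M (\<Pi>\<^sub>M p\<in>D. borel) (\<lambda>\<omega>. \<lambda>p\<in>D. Y p \<omega>) = distr N (\<Pi>\<^sub>M p\<in>D. borel) (\<lambda>\<omega>. \<lambda>p\<in>D. Z p \<omega>)"
  shows "same_law_on_C D M Y N Z"
  unfolding same_law_on_C_def
proof (intro conjI sample_path_measurable)
  show "law_on_C M D Y = law_on_C N D Z"
  proof (rule measure_eqI)
    fix V assume "V \<in> sets (law_on_C M D Y)"
    then have V: "V \<in> sets (C_borel D)" by (simp add: law_on_C_def)
    then obtain A where A: "A \<in> sets (\<Pi>\<^sub>M p\<in>D. borel)" "V = C_space D \<inter> A"
      using C_borel_subset_cylinder[of D] by (auto simp: sets_restrict_space)
    show "emeasure (law_on_C M D Y) V = emeasure (law_on_C N D Z) V"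
      using emeasure_law_on_C[OF assms(1,3) V A] emeasure_law_on_C[OF assms(2,4) V A] eq by simp
  qed (simp add: law_on_C_def)
qed (use assms in auto)

section \<open>Transferring path continuity between fields of equal law\<close>

text \<open>It would not be enough for \<open>Q\<close> to be dense in \<open>D\<close>: the
  second hypothesis says that the graph of \<open>f\<close> over \<open>Q\<close> is dense in the graph of \<open>f\<close> over \<open>D\<close>, which excludes that \<open>f\<close> differs
  from the continuous extension of its values on \<open>Q\<close>.\<close>
lemma continuous_on_if_uniformly_continuous_on_dense:
  fixes f :: "'a::real_normed_vector \<Rightarrow> 'b::metric_space"
  assumes uc: "\<And>n. uniformly_continuous_on (Q \<inter> cball 0 (real n)) f"
    and dense: "\<And>p e. p \<in> D \<Longrightarrow> e > 0 \<Longrightarrow> \<exists>q\<in>Q. dist q p < e \<and> dist (f q) (f p) < e"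
  shows "continuous_on D f"
  unfolding continuous_on_iff
proof (intro ballI allI impI)
  fix p e assume p: "p \<in> D" and e: "(e::real) > 0"
  obtain n where n: "norm p + 2 \<le> real n" using real_arch_simple by blast
  have "e / 3 > 0" using e by simp
  then obtain d where d: "d > 0" and df: "\<And>q q'. q \<in> Q \<inter> cball 0 (real n) \<Longrightarrow> q' \<in> Q \<inter> cball 0 (real n) \<Longrightarrow>
      dist q' q < d \<Longrightarrow> dist (f q') (f q) < e / 3"
    using uc[of n] unfolding uniformly_continuous_on_def by blast
  define r where "r = Min {d / 3, e / 3, 1}"
  have r: "r > 0" "r \<le> d / 3" "r \<le> e / 3" "r \<le> 1" using d e by (auto simp: r_def)
  have "dist (f p') (f p) < e" if p': "p' \<in> D" "dist p' p < r" for p'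
  proof -
    obtain q where q: "q \<in> Q" "dist q p < r" "dist (f q) (f p) < r" using dense p r by blast
    obtain q' where q': "q' \<in> Q" "dist q' p' < r" "dist (f q') (f p') < r" using dense p' r by blast
    have qq: "dist q' q < d"
      using dist_triangle[of q' q p'] dist_triangle[of p' q p] q q' p' r by (simp add: dist_commute)
    have "norm q \<le> norm p + 1" 
      using norm_triangle_ineq[of "q - p" p] q r by (simp add: dist_norm)
    moreover have "norm q' \<le> norm p + 2"
      using norm_triangle_ineq[of "q' - p'" p'] norm_triangle_ineq[of "p' - p" p] q' p' r by (simp add: dist_norm)
    ultimately have "dist (f q') (f q) < e / 3" using df[of q q'] q q' qq n by auto
    then show ?thesis
      using dist_triangle[of "f p'" "f p" "f q'"] dist_triangle[of "f q'" "f p" "f q"] q q' r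
      by (simp add: dist_commute)
  qed
  then show "\<exists>d>0. \<forall>x'\<in>D. dist x' p < d \<longrightarrow> dist (f x') (f p) < e" using r by blast
qed

text \<open>Path continuity of \<open>Z\<close> is visible in the countably many
  coordinates from \<open>Q\<close>, as uniform continuity on bounded parts of \<open>Q\<close>: there it is an event, whose
  probability is shared by \<open>Y\<close>. Closedness of \<open>D\<close> makes its bounded parts relatively compact in \<open>D\<close>, so that
  the continuous paths of \<open>Z\<close> are uniformly continuous on them.\<close>
lemma as_continuous_transfer:
  assumes eq: "distr M (\<Pi>\<^sub>M p\<in>D. borel) (\<lambda>\<omega>. \<lambda>p\<in>D. Y p \<omega>) = distr N (\<Pi>\<^sub>M p\<in>D. borel) (\<lambda>\<omega>. \<lambda>p\<in>D. Z p \<omega>)"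
    and mY: "\<And>p. p \<in> D \<Longrightarrow> Y p \<in> borel_measurable M" and mZ: "\<And>p. p \<in> D \<Longrightarrow> Z p \<in> borel_measurable N"
    and D: "closed D" and Z: "as_continuous N D Z" and Q: "countable Q" "Q \<subseteq> D"
    and dense: "AE \<omega> in M. \<forall>p\<in>D. \<forall>e>0. \<exists>q\<in>Q. dist q p < e \<and> dist (Y q \<omega>) (Y p \<omega>) < e"
  shows "as_continuous M D Y"
proof -
  let ?P = "\<Pi>\<^sub>M p\<in>D. borel :: real measure"
  define B where "B n = Q \<inter> cball 0 (real n)" for n
  have B: "countable (B n)" "B n \<subseteq> D" for n using Q by (auto simp: B_def)
  define E where "E x \<longleftrightarrow> (\<forall>n k::nat. \<exists>m::nat. \<forall>p\<in>B n. \<forall>q\<in>B n.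
      dist p q < inverse (Suc m) \<longrightarrow> dist (x p) (x q) \<le> inverse (Suc k))" for x :: "real \<times> real \<Rightarrow> real"
  have E_iff: "E x \<longleftrightarrow> (\<forall>n. uniformly_continuous_on (B n) x)" for x
  proof
    assume x: "E x"
    show "\<forall>n. uniformly_continuous_on (B n) x"
      unfolding uniformly_continuous_on_def
    proof (intro allI impI)
      fix n and e :: real assume "e > 0"
      then obtain k where k: "inverse (Suc k) < e" using reals_Archimedean by blast
      obtain m where "\<forall>p\<in>B n. \<forall>q\<in>B n. dist p q < inverse (Suc m) \<longrightarrow> dist (x p) (x q) \<le> inverse (Suc k)"
        using x unfolding E_def by blast
      with k have "\<forall>p\<in>B n. \<forall>q\<in>B n. dist q p < inverse (Suc m) \<longrightarrow> dist (x q) (x p) < e"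
        by fastforce
      then show "\<exists>d>0. \<forall>p\<in>B n. \<forall>q\<in>B n. dist q p < d \<longrightarrow> dist (x q) (x p) < e"
        by (intro exI[of _ "inverse (real (Suc m))"]) simp
    qed
  next
    assume x: "\<forall>n. uniformly_continuous_on (B n) x"
    show "E x"
      unfolding E_def
    proof (intro allI)
      fix n k
      have "inverse (real (Suc k)) > 0" by simp
      then obtain d where d: "d > 0" "\<forall>p\<in>B n. \<forall>q\<in>B n. dist q p < d \<longrightarrow> dist (x q) (x p) < inverse (real (Suc k))"
        using x unfolding uniformly_continuous_on_def by blast
      obtain m where "inverse (Suc m) < d" using d(1) reals_Archimedean by blast
      then have "\<forall>p\<in>B n. \<forall>q\<in>B n. dist p q < inverse (Suc m) \<longrightarrow> dist (x p) (x q) \<le> inverse (Suc k)"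
        using d(2) by (meson less_imp_le less_trans)
      then show "\<exists>m. \<forall>p\<in>B n. \<forall>q\<in>B n. dist p q < inverse (real (Suc m)) \<longrightarrow> dist (x p) (x q) \<le> inverse (real (Suc k))"
        by blast
    qed
  qed
  have ev: "(\<lambda>x. x p) \<in> borel_measurable ?P" if "p \<in> D" for p
    using that by (rule measurable_component_singleton)
  have E_meas: "{x \<in> space ?P. E x} \<in> sets ?P"
    unfolding E_def
  proof (intro sets.sets_Collect_countable_All sets.sets_Collect_countable_Ex sets.sets_Collect_countable_All' B)
    fix n k m p q assume pq: "p \<in> B n" "q \<in> B n"
    then have "{x \<in> space ?P. dist (x p) (x q) \<le> inverse (Suc k)} \<in> sets ?P"
      using B(2)[of n] by (intro borel_measurable_le borel_measurable_dist borel_measurable_const ev) auto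
    then show "{x \<in> space ?P. dist p q < inverse (Suc m) \<longrightarrow> dist (x p) (x q) \<le> inverse (Suc k)} \<in> sets ?P"
      by (cases "dist p q < inverse (Suc m)") simp_all
  qed
  have rY: "(\<lambda>\<omega>. \<lambda>p\<in>D. Y p \<omega>) \<in> M \<rightarrow>\<^sub>M ?P" and rZ: "(\<lambda>\<omega>. \<lambda>p\<in>D. Z p \<omega>) \<in> N \<rightarrow>\<^sub>M ?P"
    using mY mZ by (auto intro!: measurable_restrict)
  have E_restrict: "E (\<lambda>p\<in>D. h p) \<longleftrightarrow> E h" for h
  proof -
    have "(\<lambda>p\<in>D. h p) p = h p" if "p \<in> B n" for p n
      using subsetD[OF B(2) that] by simp
    then show ?thesis
      unfolding E_def by (intro all_cong1 ex_cong1 ball_cong refl) (simp del: restrict_apply)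
  qed
  have "AE \<omega> in N. E (\<lambda>p\<in>D. Z p \<omega>)"
    using Z unfolding as_continuous_def
  proof eventually_elim
    case (elim \<omega>)
    have "uniformly_continuous_on (D \<inter> cball 0 (real n)) (\<lambda>p. Z p \<omega>)" for n
      using D elim
      by (intro compact_uniformly_continuous closed_Int_compact compact_cball)
        (rule continuous_on_subset[OF elim], auto)
    then have "uniformly_continuous_on (B n) (\<lambda>p. Z p \<omega>)" for n
      using subsetD[OF Q(2)] unfolding uniformly_continuous_on_def B_def by (metis Int_iff)
    then show ?case by (simp only: E_restrict) (simp add: E_iff)
  qed
  then have "AE x in distr N ?P (\<lambda>\<omega>. \<lambda>p\<in>D. Z p \<omega>). E x"
    using AE_distr_iff[OF rZ E_meas] by simp
  then have "AE \<omega> in M. E (\<lambda>p\<in>D. Y p \<omega>)"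
    unfolding eq[symmetric] using AE_distr_iff[OF rY E_meas] by simp
  then show ?thesis
    using dense unfolding as_continuous_def
  proof eventually_elim
    case (elim \<omega>)
    then have "\<And>n. uniformly_continuous_on (Q \<inter> cball 0 (real n)) (\<lambda>p. Y p \<omega>)"
      by (simp only: E_restrict) (simp add: E_iff B_def)
    then show ?case
      using elim(2) by (intro continuous_on_if_uniformly_continuous_on_dense) auto
  qed
qed

section \<open>Wiener, Ornstein-Uhlenbeck and Kiefer fields\<close>

abbreviation (input) quadrant :: "(real \<times> real) set" where "quadrant \<equiv> {0..} \<times> {0..}"
abbreviation (input) strip :: "(real \<times> real) set" where "strip \<equiv> {0..1} \<times> {0..}"

lemma std_wiener_fieldD:
  assumes "std_wiener_field M W"
  shows "gauss_field M quadrant W" "zero_mean M quadrant W" "as_continuous M quadrant W"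
    "\<And>p q. p \<in> quadrant \<Longrightarrow> q \<in> quadrant \<Longrightarrow>
       cov M (W p) (W q) = min (fst p) (fst q) * min (snd p) (snd q)"
proof -
  show "gauss_field M quadrant W" "zero_mean M quadrant W" "as_continuous M quadrant W"
    using assms unfolding std_wiener_field_def by blast+
  have "cov M (W (s, t)) (W (s', t')) = min s s' * min t t'"
    if "s \<ge> 0" "t \<ge> 0" "s' \<ge> 0" "t' \<ge> 0" for s t s' t'
    using assms that unfolding std_wiener_field_def by blast
  then show "cov M (W p) (W q) = min (fst p) (fst q) * min (snd p) (snd q)"
    if "p \<in> quadrant" "q \<in> quadrant" for p q
    using that by (cases p, cases q) simp
qed

lemma stationary_OU_field_exp_wiener:
  assumes W: "std_wiener_field M W"
    and X: "\<And>s t \<omega>. X (s, t) \<omega> = exp (- s / 2 - t / 2) * W (exp s, exp t) \<omega>"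
  shows "stationary_OU_field M X"
proof -
  note W' = std_wiener_fieldD[OF W]
  define J where "J p = {(exp (fst p), exp (snd p))}" for p :: "real \<times> real"
  define a where "a p q = exp (- fst p / 2) * exp (- snd p / 2)" for p q :: "real \<times> real"
  have J: "finite (J p) \<and> J p \<subseteq> quadrant" for p by (auto simp: J_def)
  have Xa: "X p \<omega> = (\<Sum>q\<in>J p. a p q * W q \<omega>)" for p \<omega>
    using X[of "fst p" "snd p" \<omega>] by (simp add: J_def a_def flip: exp_add)
  note lin = gauss_field_linear[OF W'(1,2), of UNIV J X a, OF J Xa]
  have "as_continuous M UNIV X"
    using W'(3) unfolding as_continuous_def
  proof eventually_elim
    case (elim \<omega>)
    have "continuous_on UNIV (\<lambda>p :: real \<times> real. exp (- fst p / 2) * exp (- snd p / 2) * W (exp (fst p), exp (snd p)) \<omega>)"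
      by (intro continuous_intros continuous_on_compose2[OF elim]) auto
    then show ?case using Xa by (simp add: J_def a_def)
  qed
  moreover have "cov M (X (s1, t1)) (X (s2, t2)) = exp (- (1/2) * \<bar>s2 - s1\<bar> - (1/2) * \<bar>t2 - t1\<bar>)"
    for s1 t1 s2 t2
  proof -
    have one_dim: "exp (- x / 2) * exp (- y / 2) * min (exp x) (exp y) = exp (- (1/2) * \<bar>y - x\<bar>)"
      for x y :: real
      by (cases "x \<le> y") (simp_all add: min_def flip: exp_add, simp_all add: field_simps)
    have "cov M (X (s1, t1)) (X (s2, t2)) =
        (exp (- s1 / 2) * exp (- s2 / 2) * min (exp s1) (exp s2)) *
        (exp (- t1 / 2) * exp (- t2 / 2) * min (exp t1) (exp t2))"
      using lin(3)[of "(s1, t1)" "(s2, t2)"]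
      by (simp add: J_def a_def W'(4) mult_ac)
    also have "\<dots> = exp (- (1/2) * \<bar>s2 - s1\<bar> - (1/2) * \<bar>t2 - t1\<bar>)"
      unfolding one_dim by (simp flip: exp_add)
    finally show ?thesis .
  qed
  ultimately show ?thesis
    unfolding stationary_OU_field_def using lin(1,2) by blast
qed

lemma kiefer_processD:
  assumes K: "kiefer_process N K"
  shows "gauss_field N strip K" "zero_mean N strip K" "as_continuous N strip K"
    "\<And>p q. p \<in> strip \<Longrightarrow> q \<in> strip \<Longrightarrow>
       cov N (K p) (K q) = (min (fst p) (fst q) - fst p * fst q) * min (snd p) (snd q)"
proof -
  obtain W where W: "std_wiener_field N W"
    and KW: "\<And>s t \<omega>. s \<in> {0..1} \<Longrightarrow> t \<ge> 0 \<Longrightarrow> \<omega> \<in> space N \<Longrightarrow> K (s, t) \<omega> = W (s, t) \<omega> - s * W (1, t) \<omega>"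
    using K unfolding kiefer_process_def by blast
  note W' = std_wiener_fieldD[OF W]
  \<comment> \<open>Indicator coefficients also cover the case \<open>p = (1, t)\<close>, where both terms of \<open>K p\<close> fall together.\<close>
  define J where "J p = {p, (1, snd p)}" for p :: "real \<times> real"
  define a where "a p q = of_bool (q = p) - fst p * of_bool (q = (1, snd p))" for p q :: "real \<times> real"
  have sum_a: "(\<Sum>q\<in>J p. a p q * h q) = h p - fst p * h (1, snd p)" for p h
    by (cases "p = (1, snd p)") (auto simp: J_def a_def algebra_simps)
  have J: "finite (J p) \<and> J p \<subseteq> quadrant" if "p \<in> strip" for p using that by (auto simp: J_def)
  have Ka: "K p \<omega> = (\<Sum>q\<in>J p. a p q * W q \<omega>)" if "p \<in> strip" "\<omega> \<in> space N" for p \<omega>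
    using KW[of "fst p" "snd p" \<omega>] that by (auto simp: sum_a)
  have lin: "gauss_field N strip K" "zero_mean N strip K"
    "\<And>p q. p \<in> strip \<Longrightarrow> q \<in> strip \<Longrightarrow>
       cov N (K p) (K q) = (\<Sum>i\<in>J p. \<Sum>j\<in>J q. a p i * a q j * cov N (W i) (W j))"
    using gauss_field_linear[of N quadrant W strip J K a] W'(1,2) J Ka by blast+
  show "gauss_field N strip K" "zero_mean N strip K" using lin(1,2) by blast+
  show "as_continuous N strip K"
    using W'(3) AE_space unfolding as_continuous_def
  proof eventually_elim
    case (elim \<omega>)
    have "continuous_on strip (\<lambda>p :: real \<times> real. W (fst p, snd p) \<omega> - fst p * W (1, snd p) \<omega>)"
      by (intro continuous_intros continuous_on_compose2[OF elim(1)]) auto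
    then show ?case
      by (rule continuous_on_eq) (use KW elim(2) in auto)
  qed
  show "cov N (K p) (K q) = (min (fst p) (fst q) - fst p * fst q) * min (snd p) (snd q)"
    if p: "p \<in> strip" and q: "q \<in> strip" for p q
  proof -
    define R where "R i j = min (fst i) (fst j) * min (snd i) (snd j)" for i j :: "real \<times> real"
    have RW: "cov N (W i) (W j) = R i j" if "i \<in> J p" "j \<in> J q" for i j
      using W'(4)[of i j] J[OF p] J[OF q] that unfolding R_def by blast
    have "cov N (K p) (K q) = (\<Sum>i\<in>J p. a p i * (\<Sum>j\<in>J q. a q j * cov N (W i) (W j)))"
      by (simp add: lin(3)[OF p q] sum_distrib_left mult.assoc)
    also have "\<dots> = (\<Sum>i\<in>J p. a p i * (\<Sum>j\<in>J q. a q j * R i j))"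
      by (intro sum.cong refl arg_cong2[of _ _ _ _ "(*)"] RW)
    also have "\<dots> = (min (fst p) (fst q) - fst p * fst q) * min (snd p) (snd q)"
      unfolding sum_a using p q by (auto simp: R_def algebra_simps)
    finally show ?thesis .
  qed
qed

lemma rational_point_near:
  fixes s t r :: real
  assumes "r > 0"
  obtains s' t' where "s' \<in> \<rat>" "t' \<in> \<rat>" "s < s'" "t < t'" "dist (s', t') (s, t) < r"
proof -
  obtain s' where s': "s' \<in> \<rat>" "s < s'" "s' < s + r / 2"
    using Rats_dense_in_real[of s "s + r / 2"] assms by auto
  obtain t' where t': "t' \<in> \<rat>" "t < t'" "t' < t + r / 2"
    using Rats_dense_in_real[of t "t + r / 2"] assms by auto
  have "dist (s', t') (s, t) \<le> \<bar>s' - s\<bar> + \<bar>t' - t\<bar>"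
    unfolding dist_Pair_Pair dist_real_def by (metis real_sqrt_abs sqrt_sum_squares_le_sum_abs power2_abs)
  then show ?thesis using s' t' by (intro that[of s' t']) auto
qed

section \<open>The transformed field is a Kiefer process in law\<close>

lemma bridge_factor:
  fixes s t :: real
  assumes "0 < s" "s < 1" "0 < t"
  shows "sqrt (s * (1 - s) * t) * exp (- ln (s / (1 - s)) / 2 - ln t / 2) = 1 - s"
proof -
  have "(sqrt (s * (1 - s) * t) * exp (- ln (s / (1 - s)) / 2 - ln t / 2))\<^sup>2 =
      s * (1 - s) * t * exp (- ln (s / (1 - s)) - ln t)"
    using assms by (simp add: power_mult_distrib flip: exp_double)
  also have "exp (- ln (s / (1 - s)) - ln t) = (1 - s) / s / t"
    using assms by (simp add: exp_diff exp_minus)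
  also have "s * (1 - s) * t * ((1 - s) / s / t) = (1 - s)\<^sup>2"
    using assms by (simp add: field_simps power2_eq_square)
  finally show ?thesis
    by (rule power2_eq_imp_eq) (use assms in simp_all)
qed

text \<open>The map \<open>s \<mapsto> s / (1 - s)\<close> is increasing; for \<open>s \<le> s'\<close> the left-hand side is
  therefore \<open>(1 - s') s\<close>.\<close>
lemma bridge_min:
  fixes s s' :: real
  assumes "0 < s" "s < 1" "0 < s'" "s' < 1"
  shows "(1 - s) * (1 - s') * min (s / (1 - s)) (s' / (1 - s')) = min s s' - s * s'"
proof -
  have *: "(1 - x) * (1 - y) * min (x / (1 - x)) (y / (1 - y)) = min x y - x * y"
    if "0 < x" "x \<le> y" "y < 1" for x y :: real
  proof -
    have "x / (1 - x) \<le> y / (1 - y)" using that by (intro frac_le) auto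
    then show ?thesis using that by (simp add: min_def field_simps)
  qed
  show ?thesis
    using *[of s s'] *[of s' s] assms by (cases "s \<le> s'") (simp_all add: min.commute mult.commute)
qed

theorem mainTheorem4:
  fixes M :: "'a measure" and N :: "'b measure"
    and W X U :: "real \<times> real \<Rightarrow> 'a \<Rightarrow> real"
    and K :: "real \<times> real \<Rightarrow> 'b \<Rightarrow> real"
  assumes W: "std_wiener_field M W"
    and X: "\<And>s t \<omega>. X (s, t) \<omega> = exp (- s / 2 - t / 2) * W (exp s, exp t) \<omega>"
    and U_inside: "\<And>s t \<omega>. 0 < s \<Longrightarrow> s < 1 \<Longrightarrow> 0 < t \<Longrightarrow>
          U (s, t) \<omega> = sqrt (s * (1 - s) * t) * X (ln (s / (1 - s)), ln t) \<omega>"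
    and U_boundary: "\<And>s t \<omega>. 0 \<le> s \<Longrightarrow> s \<le> 1 \<Longrightarrow> 0 \<le> t \<Longrightarrow>
          s = 0 \<or> s = 1 \<or> t = 0 \<Longrightarrow> U (s, t) \<omega> = 0"
    and K: "kiefer_process N K"
  shows "stationary_OU_field M X \<and> same_law_on_C ({0..1} \<times> {0..}) M U N K"
proof
  show "stationary_OU_field M X"
    using stationary_OU_field_exp_wiener[OF W X] .
  note W' = std_wiener_fieldD[OF W]
  note K' = kiefer_processD[OF K]
  define I where "I = {0<..<(1::real)} \<times> {(0::real)<..}"
  have U_bridge: "U p \<omega> = (1 - fst p) * W (fst p / (1 - fst p), snd p) \<omega>" if "p \<in> I" for p \<omega>
  proof -
    have p: "0 < fst p" "fst p < 1" "0 < snd p" using that by (auto simp: I_def)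
    then have "0 < fst p / (1 - fst p)" by simp
    then show ?thesis
      using U_inside[OF p, of \<omega>] p bridge_factor[OF p] by (simp add: X flip: mult.assoc)
  qed
  have U_zero: "U p \<omega> = 0" if "p \<in> strip - I" for p \<omega>
    using U_boundary[of "fst p" "snd p" \<omega>] that by (cases p) (auto simp: I_def)
  \<comment> \<open>At \<open>s = 1\<close> the quotient is \<open>0\<close> by convention, so the point stays in the quadrant; the
    coefficient \<open>a\<close> vanishes there.\<close>
  define J where "J p = {(fst p / (1 - fst p), snd p)}" for p :: "real \<times> real"
  define a where "a p q = (if p \<in> I then 1 - fst p else 0)" for p q :: "real \<times> real"
  have J: "finite (J p) \<and> J p \<subseteq> quadrant" if "p \<in> strip" for p
    using that by (auto simp: J_def)
  have Ua: "U p \<omega> = (\<Sum>q\<in>J p. a p q * W q \<omega>)" if "p \<in> strip" for p \<omega>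
    using that U_bridge U_zero by (simp add: J_def a_def)
  have lin: "gauss_field M strip U" "zero_mean M strip U"
    "\<And>p q. p \<in> strip \<Longrightarrow> q \<in> strip \<Longrightarrow>
       cov M (U p) (U q) = (\<Sum>i\<in>J p. \<Sum>j\<in>J q. a p i * a q j * cov M (W i) (W j))"
    using gauss_field_linear[of M quadrant W strip J U a] W'(1,2) J Ua by blast+
  have cov: "cov M (U p) (U q) = cov N (K p) (K q)" if p: "p \<in> strip" and q: "q \<in> strip" for p q
  proof -
    have "cov M (U p) (U q) = a p (0, 0) * a q (0, 0) *
        (min (fst p / (1 - fst p)) (fst q / (1 - fst q)) * min (snd p) (snd q))"
      using lin(3)[OF p q] J[OF p] J[OF q] by (simp add: J_def a_def W'(4))
    also have "\<dots> = (min (fst p) (fst q) - fst p * fst q) * min (snd p) (snd q)"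
    proof (cases "p \<in> I \<and> q \<in> I")
      case True
      then show ?thesis
        using bridge_min[of "fst p" "fst q"] by (auto simp: a_def I_def)
    next
      case False
      then have "fst p = 0 \<or> fst p = 1 \<or> snd p = 0 \<or> fst q = 0 \<or> fst q = 1 \<or> snd q = 0"
        using p q by (auto simp: I_def)
      then have "(min (fst p) (fst q) - fst p * fst q) * min (snd p) (snd q) = 0"
        using p q by (auto simp: min_def)
      moreover have "a p (0, 0) * a q (0, 0) = 0" using False by (auto simp: a_def)
      ultimately show ?thesis by (simp only: mult_zero_left)
    qed
    finally show ?thesis using K'(4)[OF p q] by simp
  qed
  have law: "distr M (\<Pi>\<^sub>M p\<in>strip. borel) (\<lambda>\<omega>. \<lambda>p\<in>strip. U p \<omega>) =
      distr N (\<Pi>\<^sub>M p\<in>strip. borel) (\<lambda>\<omega>. \<lambda>p\<in>strip. K p \<omega>)"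
    using gauss_field_law_unique[OF lin(1,2) K'(1,2) cov] .
  note mU = gauss_field_measurable[OF lin(1)] and mK = gauss_field_measurable[OF K'(1)]
  define Q where "Q = strip \<inter> \<rat> \<times> \<rat>"
  have Q: "countable Q" "Q \<subseteq> strip"
    unfolding Q_def by (auto intro!: countable_Int2 countable_SIGMA countable_rat)
  have dense: "AE \<omega> in M. \<forall>p\<in>strip. \<forall>e>0. \<exists>q\<in>Q. dist q p < e \<and> dist (U q \<omega>) (U p \<omega>) < e"
    using W'(3) unfolding as_continuous_def
  proof eventually_elim
    case (elim \<omega>)
    have "continuous_on I (\<lambda>p. (1 - fst p) * W (fst p / (1 - fst p), snd p) \<omega>)"
      by (intro continuous_intros continuous_on_compose2[OF elim]) (auto simp: I_def)
    then have contU: "continuous_on I (\<lambda>p. U p \<omega>)"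
      by (rule continuous_on_eq) (simp add: U_bridge)
    show ?case
    proof (intro ballI allI impI)
      fix p and e :: real assume p: "p \<in> strip" and e: "e > 0"
      obtain s t where st: "p = (s, t)" by fastforce
      consider "p \<in> I" | "s = 0 \<or> s = 1" | "0 < s" "s < 1" "t = 0"
      proof -
        have "p \<in> I \<or> (s = 0 \<or> s = 1) \<or> (0 < s \<and> s < 1 \<and> t = 0)"
          using p by (auto simp: I_def st)
        then show thesis using that by blast
      qed
      then show "\<exists>q\<in>Q. dist q p < e \<and> dist (U q \<omega>) (U p \<omega>) < e"
      proof cases
        case 1
        obtain d where d: "d > 0" "\<And>q. q \<in> I \<Longrightarrow> dist q p < d \<Longrightarrow> dist (U q \<omega>) (U p \<omega>) < e"
          using contU[unfolded continuous_on_iff, rule_format, OF 1 e] by blast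
        define r where "r = Min {d, e, 1 - s}"
        have r: "r > 0" "r \<le> d" "r \<le> e" "r \<le> 1 - s" using d e 1 by (auto simp: r_def st I_def)
        obtain s' t' where q: "s' \<in> \<rat>" "t' \<in> \<rat>" "s < s'" "t < t'" "dist (s', t') (s, t) < r"
          using rational_point_near[OF r(1)] by blast
        have "dist s' s < r" using dist_fst_le[of "(s', t')" "(s, t)"] q by simp
        then have I: "(s', t') \<in> I" using q r 1 by (auto simp: I_def st dist_real_def)
        then have "(s', t') \<in> Q" using q by (auto simp: Q_def I_def)
        moreover have "dist (s', t') p < e" "dist (U (s', t') \<omega>) (U p \<omega>) < e"
          using d(2)[OF I] q r by (auto simp: st)
        ultimately show ?thesis by blast
      next
        case 2
        obtain t' where t': "t' \<in> \<rat>" "t < t'" "t' < t + e"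
          using Rats_dense_in_real[of t "t + e"] e by auto
        have "(s, t') \<in> Q" using 2 t' p by (auto simp: Q_def st)
        moreover have "dist (s, t') p < e" using t' by (simp add: st dist_Pair_Pair dist_real_def)
        moreover have "U (s, t') \<omega> = 0" "U p \<omega> = 0"
          using 2 p t' by (auto intro!: U_zero simp: st I_def)
        ultimately show ?thesis using e by (intro bexI[of _ "(s, t')"]) auto
      next
        case 3
        obtain s' where s': "s' \<in> \<rat>" "s < s'" "s' < min 1 (s + e)"
          using Rats_dense_in_real[of s "min 1 (s + e)"] e 3 by auto
        have "(s', 0) \<in> Q" using 3 s' by (auto simp: Q_def)
        moreover have "dist (s', 0) p < e" using s' 3 by (simp add: st dist_Pair_Pair dist_real_def)
        moreover have "U (s', 0) \<omega> = 0" "U p \<omega> = 0"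
          using 3 p s' by (auto intro!: U_zero simp: st I_def)
        ultimately show ?thesis using e by (intro bexI[of _ "(s', 0)"]) auto
      qed
    qed
  qed
  have "as_continuous M strip U"
    by (rule as_continuous_transfer[OF law mU mK _ K'(3) Q dense]) (auto intro: closed_Times)
  then show "same_law_on_C strip M U N K"
    using K'(3) mU mK law by (rule same_law_on_CI)
qed

end
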